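(* Let $n\ge 1$, $N=2^n$, let $f:\mathcal{B}_n\to\mathbb{R}$, and enumerate $\mathcal{B}_n=\{s_1,\dots,s_N\}$ so that $f(s_1)\le f(s_2)\le\cdots\le f(s_N)$. Let $p_\theta$ be a (fixed) probability distribution on $\mathcal{B}_n$. Suppose that the cardinality of each neighborhood $\mathcal{N}(s_i)$ is fixed with $|\mathcal{N}(s_i)|\ge X\ge n+1$, where $X$ is an integer, that $s_i\in\mathcal{N}(s_i)$, and that all elements of $\mathcal{N}(s_i)$ except $s_i$ are chosen uniformly at random from $\mathcal{B}_n\setminus\{s_i\}$. Let $T$ be the filter function induced by these neighborhoods. For $\delta\in(0,1)$, let $$M=\left\lceil\frac{\log(N/\delta)}{X-1}\,N\right\rceil+1,$$ and assume $M\le N$. Then, with probability at least $1-\delta$ over the choice of $T$, both of the following hold: 1) $f(T(x))\in[f(s_1),f(s_M)]$ for all $x\in\mathcal{B}_n$; 2) $\displaystyle \mathbb{E}_{x\sim p_\theta}[f(T(x))]\le \sum_{i=1}^{M-1}p_\theta(s_i)f(s_i)+\Big(1-\sum_{i=1}^{M-1}p_\theta(s_i)\Big)f(s_M)\le f(s_M).$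
   Context: $\mathcal{B}_n=\{-1,1\}^n$. Given, for each $x\in\mathcal{B}_n$, a neighborhood $\mathcal{N}(x)\subset\mathcal{B}_n$ with $x\in\mathcal{N}(x)$ and $|\mathcal{N}(x)|\ge 2$, the filter function induced by $\mathcal{N}$ is a map $T:\mathcal{B}_n\to\mathcal{B}_n$ with $$T(x)\in\arg\min_{\hat x\in\mathcal{N}(x)}f(\hat x),$$ chosen arbitrarily if there are several minimizers. "Chosen uniformly at random" means that $\mathcal{N}(s_i)\setminus\{s_i\}$ is a uniformly random subset of $\mathcal{B}_n\setminus\{s_i\}$ of the prescribed cardinality. $\log$ is the natural logarithm. *)

theory Defs
  imports "HOL-Probability.Probability"
begin

text \<open>
  Points of the cube are extensional functions on \<open>{..<n}\<close>, so that the cube has exactly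
  \<open>2 ^ n\<close> elements.
\<close>

type_synonym point = "nat \<Rightarrow> int"

definition cube :: "nat \<Rightarrow> point set" where
  "cube n = ({..<n} \<rightarrow>\<^sub>E {-1, 1})"

definition neighborhoods :: "nat \<Rightarrow> (point \<Rightarrow> point set) \<Rightarrow> bool" where
  "neighborhoods n Nb \<longleftrightarrow>
     (\<forall>x\<in>cube n. Nb x \<subseteq> cube n \<and> x \<in> Nb x \<and> 2 \<le> card (Nb x))"

text \<open>Ties between minimizers may be broken in any way, hence a predicate on \<open>T\<close>.\<close>

definition filter_function ::
    "nat \<Rightarrow> (point \<Rightarrow> real) \<Rightarrow> (point \<Rightarrow> point set) \<Rightarrow> (point \<Rightarrow> point) \<Rightarrow> bool" where
  "filter_function n f Nb T \<longleftrightarrow>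
     (\<forall>x\<in>cube n. is_arg_min f (\<lambda>y. y \<in> Nb x) (T x))"

text \<open>
  The neighborhoods are random elements on a probability space \<open>P\<close>, with prescribed
  cardinalities \<open>k\<close>. Only the law of each single neighborhood is prescribed; the joint law of
  the family is arbitrary, independent choices being one instance.
\<close>

definition uniform_random_neighborhoods ::
    "'w measure \<Rightarrow> nat \<Rightarrow> (point \<Rightarrow> nat) \<Rightarrow> ('w \<Rightarrow> point \<Rightarrow> point set) \<Rightarrow> bool" where
  "uniform_random_neighborhoods P n k Nb \<longleftrightarrow>
     (\<forall>\<omega>\<in>space P. neighborhoods n (Nb \<omega>) \<and> (\<forall>x\<in>cube n. card (Nb \<omega> x) = k x)) \<and>
     (\<forall>x\<in>cube n.
        (\<lambda>\<omega>. Nb \<omega> x) \<in> measurable P (count_space UNIV) \<and>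
        distr P (count_space UNIV) (\<lambda>\<omega>. Nb \<omega> x - {x}) =
          measure_pmf (pmf_of_set {A. A \<subseteq> cube n - {x} \<and> card A = k x - 1}))"

end

theory Submission
  imports Defs
begin

text \<open>
  Call \<open>x\<close> bad if its neighborhood misses \<open>{s\<^sub>1, \<dots>, s\<^sub>M}\<close>; then \<open>x\<close> itself lies outside this set.
  For a uniformly random neighborhood this has probability
  \<open>(N - 1 - M choose k - 1) / (N - 1 choose k - 1) \<le> exp (- (k - 1) M / (N - 1)) \<le> \<delta> / N\<close>,
  so by the union bound no point is bad with probability at least \<open>1 - \<delta>\<close>. If no point is bad, then
  \<open>f (T x) \<le> f s\<^sub>M\<close> for all \<open>x\<close>, and averaging this together with \<open>f (T x) \<le> f x\<close> gives the bound on
  the expectation.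
\<close>

section \<open>Binomial quotients and random subsets of fixed size\<close>

text \<open>The quotient of the two binomials is the product of the factors (c - j) / (b - j) for j
  < k, each at most c / b. Clearing denominators keeps the induction in \<open>nat\<close>.\<close>

lemma binomial_mult_power_le:
  assumes "c \<le> b"
  shows "(c choose k) * b ^ k \<le> (b choose k) * c ^ k"
proof (induction k)
  case (Suc k)
  have rec: "Suc k * (m choose Suc k) = (m - k) * (m choose k)" for m :: nat
    by (metis binomial_absorb_comp binomial_absorption)
  \<comment> \<open>This is (c - k) / (b - k) <= c / b in cleared form. With truncated subtraction
    it remains true when \<open>k\<close> exceeds \<open>c\<close> or \<open>b\<close>.\<close>
  have le: "(c - k) * b \<le> (b - k) * c"
    unfolding diff_mult_distrib mult.commute[of c b]
    by (intro diff_le_mono2 mult_le_mono2 assms)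
  have "Suc k * ((c choose Suc k) * b ^ Suc k) = (Suc k * (c choose Suc k)) * (b * b ^ k)"
    by (simp only: power_Suc mult.assoc)
  also have "\<dots> = ((c - k) * b) * ((c choose k) * b ^ k)"
    unfolding rec by (simp only: ac_simps)
  also have "\<dots> \<le> ((b - k) * c) * ((b choose k) * c ^ k)"
    by (rule mult_mono[OF le Suc.IH]) auto
  also have "\<dots> = (Suc k * (b choose Suc k)) * (c * c ^ k)"
    unfolding rec by (simp only: ac_simps)
  also have "\<dots> = Suc k * ((b choose Suc k) * c ^ Suc k)"
    by (simp only: power_Suc mult.assoc)
  finally show ?case
    by (simp only: Suc_mult_le_cancel1)
qed simp

text \<open>The quotient is at most (1 - m/b)^k, and 1 + t <= exp t with t = -m/b finishes.\<close>

lemma binomial_ratio_le_exp: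
  assumes "m \<le> b" "k \<le> b" "b > 0"
  shows "real (b - m choose k) / real (b choose k) \<le> exp (- (real k * real m / real b))"
proof -
  have "real ((b - m choose k) * b ^ k) \<le> real ((b choose k) * (b - m) ^ k)"
    using binomial_mult_power_le[of "b - m" b k] by (subst of_nat_le_iff) simp
  then have "real (b - m choose k) / real (b choose k) \<le> (real (b - m) / real b) ^ k"
    using assms by (simp add: field_simps power_divide)
  also have "real (b - m) / real b = 1 + - (real m / real b)"
    using assms by (simp add: of_nat_diff field_simps)
  \<comment> \<open>Raising to the power \<open>k\<close> is monotone here because
    \<open>m \<le> b\<close> makes the base nonnegative.\<close>
  also have "(1 + - (real m / real b)) ^ k \<le> exp (- (real m / real b)) ^ k"
    using assms by (intro power_mono exp_ge_add_one_self) (simp add: field_simps)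
  also have "\<dots> = exp (- (real k * real m / real b))"
    by (simp flip: exp_of_nat_mult)
  finally show ?thesis .
qed

text \<open>The \<open>k\<close>-subsets of \<open>B\<close> that avoid \<open>S\<close> are exactly
  the \<open>k\<close>-subsets of \<open>B - S\<close>, so the probability is a quotient of
  binomials.\<close>

lemma prob_random_subset_disjoint_le:
  fixes B S :: "'a set"
  assumes "finite B" "S \<subseteq> B" "k \<le> card B" "B \<noteq> {}"
  shows "measure_pmf.prob (pmf_of_set {A. A \<subseteq> B \<and> card A = k}) {A. A \<inter> S = {}}
    \<le> exp (- (real k * real (card S) / real (card B)))"
proof -
  let ?F = "{A. A \<subseteq> B \<and> card A = k}"
  have card_F: "card ?F = (card B choose k)"
    using n_subsets[OF assms(1)] by simp
  have "finite ?F"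
    using assms(1) by simp
  moreover have "?F \<noteq> {}"
    using card_F assms(3) by (metis binomial_eq_0_iff card.empty not_less)
  ultimately have "measure_pmf.prob (pmf_of_set ?F) {A. A \<inter> S = {}}
      = real (card (?F \<inter> {A. A \<inter> S = {}})) / real (card ?F)"
    by (simp add: measure_pmf_of_set)
  also have "?F \<inter> {A. A \<inter> S = {}} = {A. A \<subseteq> B - S \<and> card A = k}"
    by auto
  also have "card \<dots> = (card B - card S choose k)"
    using assms n_subsets[of "B - S" k] by (simp add: card_Diff_subset finite_subset)
  finally show ?thesis
    using binomial_ratio_le_exp[of "card S" "card B" k] assms card_F
    by (simp add: card_mono card_gt_0_iff)
qed

section \<open>A single random neighborhood in the cube\<close>

lemma finite_cube: "finite (cube n)"
  unfolding cube_def by (intro finite_PiE) auto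

lemma card_cube: "card (cube n) = 2 ^ n"
  by (simp add: cube_def card_PiE numeral_2_eq_2)

lemma prob_neighborhood_misses_le:
  assumes "prob_space P" "uniform_random_neighborhoods P n k Nb" "n \<ge> 1"
    and "x \<in> cube n" "S \<subseteq> cube n - {x}"
  shows "measure P {\<omega> \<in> space P. (Nb \<omega> x - {x}) \<inter> S = {}}
    \<le> exp (- (real (k x - 1) * real (card S) / real (2 ^ n - 1)))"
proof -
  interpret prob_space P by fact
  let ?B = "cube n - {x}"
  let ?g = "\<lambda>\<omega>. Nb \<omega> x - {x}"
  have meas: "(\<lambda>\<omega>. Nb \<omega> x) \<in> measurable P (count_space UNIV)"
    and law: "distr P (count_space UNIV) ?g
      = measure_pmf (pmf_of_set {A. A \<subseteq> ?B \<and> card A = k x - 1})"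
    using assms(2,4) by (auto simp: uniform_random_neighborhoods_def)
  have "?g \<in> measurable P (count_space UNIV)"
    by (rule measurable_compose[OF meas]) simp
  then have "measure (distr P (count_space UNIV) ?g) {A. A \<inter> S = {}}
      = measure P {\<omega> \<in> space P. ?g \<omega> \<inter> S = {}}"
    by (subst measure_distr) (auto intro!: arg_cong[where f = "measure P"])
  moreover have card_B: "card ?B = 2 ^ n - 1"
    using assms(4) by (simp add: finite_cube card_cube)
  moreover have "?B \<noteq> {}"
  proof -
    have "(2::nat) ^ 1 \<le> 2 ^ n"
      using assms(3) by (intro power_increasing) auto
    then show ?thesis
      using card_B by (metis card.empty diff_is_0_eq not_one_le_zero one_add_one
        power_one_right add_le_same_cancel1 le_trans)
  qed
  \<comment> \<open>The bound on \<open>k x\<close> is read off from the neighborhood at an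
    arbitrary sample point; one exists since a probability space is nonempty.\<close>
  moreover have "k x - 1 \<le> card ?B"
  proof -
    obtain \<omega> where "\<omega> \<in> space P"
      using not_empty by blast
    then have "Nb \<omega> x \<subseteq> cube n" "card (Nb \<omega> x) = k x"
      using assms(2,4) by (auto simp: uniform_random_neighborhoods_def neighborhoods_def)
    then have "k x \<le> 2 ^ n"
      using card_mono[OF finite_cube] card_cube by metis
    then show ?thesis
      using card_B by simp
  qed
  ultimately show ?thesis
    using prob_random_subset_disjoint_le[of ?B S "k x - 1"] assms(5) law finite_cube
    by simp
qed

section \<open>Weighted means of capped values\<close>

text \<open>The first \<open>M - 1\<close> terms are bounded through \<open>v\<close>, the others
  through \<open>c\<close>; the latter carry the remaining weight. It is applied with
  \<open>u i = f (T \<omega> (s i))\<close>, \<open>v i = f (s i)\<close> and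
  \<open>c = f (s M)\<close>.\<close>

lemma sum_capped_values_le:
  fixes u v w :: "nat \<Rightarrow> real"
  assumes "1 \<le> M" "M \<le> N"
    and w: "\<And>i. w i \<ge> 0" "(\<Sum>i=1..N. w i) = 1"
    and v: "\<And>i. i \<in> {1..N} \<Longrightarrow> u i \<le> v i" "\<And>i. i \<in> {1..N} \<Longrightarrow> u i \<le> c"
  shows "(\<Sum>i=1..N. w i * u i) \<le> (\<Sum>i=1..M - 1. w i * v i) + (1 - (\<Sum>i=1..M - 1. w i)) * c"
proof -
  have split: "(\<Sum>i=1..N. h i) = (\<Sum>i=1..M - 1. h i) + (\<Sum>i=M..N. h i)" for h :: "nat \<Rightarrow> real"
  proof -
    have "{1..N} = {1..M - 1} \<union> {M..N}"
      using assms by auto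
    then show ?thesis
      by (simp add: sum.union_disjoint)
  qed
  have "(\<Sum>i=1..N. w i * u i) \<le> (\<Sum>i=1..M - 1. w i * v i) + (\<Sum>i=M..N. w i * c)"
    unfolding split using assms by (intro add_mono sum_mono mult_left_mono) auto
  also have "(\<Sum>i=M..N. w i * c) = (1 - (\<Sum>i=1..M - 1. w i)) * c"
    using w(2) split[of w] by (simp flip: sum_distrib_right)
  finally show ?thesis .
qed

text \<open>The left side is \<open>c\<close> plus the sum of the terms
  \<open>w i * (v i - c)\<close>, none of which is positive.\<close>

lemma capped_mean_le:
  fixes v w :: "'a \<Rightarrow> real"
  assumes "\<And>i. w i \<ge> 0" "\<And>i. i \<in> A \<Longrightarrow> v i \<le> c"
  shows "(\<Sum>i\<in>A. w i * v i) + (1 - (\<Sum>i\<in>A. w i)) * c \<le> c"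
proof -
  have "(\<Sum>i\<in>A. w i * v i) \<le> (\<Sum>i\<in>A. w i * c)"
    using assms by (intro sum_mono mult_left_mono) auto
  then show ?thesis
    by (simp add: algebra_simps sum_distrib_left)
qed

theorem lemma2:
  fixes n X M N :: nat
    and f :: "point \<Rightarrow> real"
    and s :: "nat \<Rightarrow> point"
    and p :: "point pmf"
    and P :: "'w measure"
    and k :: "point \<Rightarrow> nat"
    and Nb :: "'w \<Rightarrow> point \<Rightarrow> point set"
    and T :: "'w \<Rightarrow> point \<Rightarrow> point"
    and \<delta> :: real
  assumes "n \<ge> 1"
    and "N = 2 ^ n"
    and "bij_betw s {1..N} (cube n)"
    and "\<And>i j. 1 \<le> i \<Longrightarrow> i \<le> j \<Longrightarrow> j \<le> N \<Longrightarrow> f (s i) \<le> f (s j)"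
    and "set_pmf p \<subseteq> cube n"
    and "prob_space P"
    and "X \<ge> n + 1"
    and "\<And>x. x \<in> cube n \<Longrightarrow> k x \<ge> X"
    and "uniform_random_neighborhoods P n k Nb"
    and "\<And>\<omega>. \<omega> \<in> space P \<Longrightarrow> filter_function n f (Nb \<omega>) (T \<omega>)"
    and "0 < \<delta>" and "\<delta> < 1"
    and "int M = \<lceil>ln (real N / \<delta>) / (real X - 1) * real N\<rceil> + 1"
    and "M \<le> N"
  shows "measure P {\<omega> \<in> space P.
      (\<forall>x\<in>cube n. f (T \<omega> x) \<in> {f (s 1)..f (s M)}) \<and>
      measure_pmf.expectation p (\<lambda>x. f (T \<omega> x))
        \<le> (\<Sum>i=1..M - 1. pmf p (s i) * f (s i)) + (1 - (\<Sum>i=1..M - 1. pmf p (s i))) * f (s M) \<and>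
      (\<Sum>i=1..M - 1. pmf p (s i) * f (s i)) + (1 - (\<Sum>i=1..M - 1. pmf p (s i))) * f (s M)
        \<le> f (s M)} \<ge> 1 - \<delta>"
proof -
  interpret prob_space P by fact
  note [simp] = assms(2)
  let ?S = "s ` {1..M}"
  \<comment> \<open>\<open>?G\<close> and \<open>?bad\<close> mention only \<open>Nb\<close>, whose
    values at each point are measurable; \<open>T\<close> is an arbitrary choice of minimizers with
    no measurability assumed.\<close>
  let ?G = "{\<omega> \<in> space P. \<forall>x\<in>cube n. \<exists>y\<in>Nb \<omega> x. f y \<le> f (s M)}"
  let ?bad = "\<lambda>x. {\<omega> \<in> space P. \<not> (\<exists>y\<in>Nb \<omega> x. f y \<le> f (s M))}"
  have N_pos: "real N > 0" and X_gt: "real X - 1 > 0"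
    using assms(1,7) by auto
  have "1 \<le> real N"
    by simp
  then have "\<delta> < real N"
    using assms(12) by linarith
  \<comment> \<open>The ceiling in the definition of \<open>M\<close> is thus taken of a positive
    number. This yields \<open>1 \<le> M\<close>, so \<open>s M\<close> is an enumerated point and
    \<open>M - 1\<close> is not truncated.\<close>
  then have ln_pos: "ln (real N / \<delta>) > 0"
    using assms(11) by simp
  have "ln (real N / \<delta>) / (real X - 1) * real N \<le> real_of_int (int M - 1)"
    unfolding assms(13) by simp
  then have M_ge: "ln (real N / \<delta>) / (real X - 1) * real N \<le> real M - 1"
    by simp
  moreover have "ln (real N / \<delta>) / (real X - 1) * real N > 0"
    using ln_pos X_gt N_pos by (intro mult_pos_pos divide_pos_pos)
  ultimately have M_pos: "1 \<le> M"
    by linarith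
  have s_in: "s i \<in> cube n" if "i \<in> {1..N}" for i
    using assms(3) that by (auto simp: bij_betw_def)
  have S_sub: "?S \<subseteq> cube n"
    using s_in assms(14) by auto
  have card_S: "card ?S = M"
    using assms(3,14) by (subst card_image) (auto simp: bij_betw_def intro: inj_on_subset)
  have f_S: "f y \<le> f (s M)" if "y \<in> ?S" for y
    using that assms(4,14) by auto
  have f_ge: "f (s 1) \<le> f y" if "y \<in> cube n" for y
  proof -
    have "y \<in> s ` {1..N}"
      using that bij_betw_imp_surj_on[OF assms(3)] by (simp only:)
    then obtain i where "i \<in> {1..N}" "y = s i"
      by blast
    then show ?thesis
      using assms(4)[of 1 i] by simp
  qed
  have nbh: "x \<in> Nb \<omega> x" "Nb \<omega> x \<subseteq> cube n" if "\<omega> \<in> space P" "x \<in> cube n" for \<omega> x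
    using assms(9) that by (auto simp: uniform_random_neighborhoods_def neighborhoods_def)
  have T_in: "T \<omega> x \<in> Nb \<omega> x" and T_le: "\<And>y. y \<in> Nb \<omega> x \<Longrightarrow> f (T \<omega> x) \<le> f y"
    if "\<omega> \<in> space P" "x \<in> cube n" for \<omega> x
    using assms(10)[OF that(1)] that(2)
    by (auto simp: filter_function_def is_arg_min_def not_less)
  \<comment> \<open>A minimum over \<open>Nb \<omega> x\<close> is at most \<open>f (s M)\<close>
    iff some value there is; the lower bound \<open>f (s 1)\<close> is automatic.\<close>
  have event: "(\<forall>x\<in>cube n. f (T \<omega> x) \<in> {f (s 1)..f (s M)}) \<longleftrightarrow>
      (\<forall>x\<in>cube n. \<exists>y\<in>Nb \<omega> x. f y \<le> f (s M))" if "\<omega> \<in> space P" for \<omega>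
  proof (intro ball_cong refl)
    fix x assume x: "x \<in> cube n"
    have "f (s 1) \<le> f (T \<omega> x)"
      using T_in[OF that x] nbh(2)[OF that x] f_ge by blast
    moreover have "f (T \<omega> x) \<le> f (s M) \<longleftrightarrow> (\<exists>y\<in>Nb \<omega> x. f y \<le> f (s M))"
      using T_in[OF that x] T_le[OF that x] order_trans by blast
    ultimately show "f (T \<omega> x) \<in> {f (s 1)..f (s M)} \<longleftrightarrow> (\<exists>y\<in>Nb \<omega> x. f y \<le> f (s M))"
      by simp
  qed
  have sum_p: "(\<Sum>i=1..N. pmf p (s i)) = 1"
  proof -
    have "(\<Sum>i=1..N. pmf p (s i)) = sum (pmf p) (cube n)"
      by (rule sum.reindex_bij_betw[OF assms(3)])
    also have "\<dots> = 1"
      by (rule sum_pmf_eq_1[OF finite_cube assms(5)])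
    finally show ?thesis .
  qed
  have mean: "measure_pmf.expectation p (\<lambda>x. f (T \<omega> x))
      \<le> (\<Sum>i=1..M - 1. pmf p (s i) * f (s i)) + (1 - (\<Sum>i=1..M - 1. pmf p (s i))) * f (s M)"
    if "\<omega> \<in> space P" and cap: "\<forall>x\<in>cube n. f (T \<omega> x) \<in> {f (s 1)..f (s M)}" for \<omega>
  proof -
    have "measure_pmf.expectation p (\<lambda>x. f (T \<omega> x)) = (\<Sum>x\<in>cube n. pmf p x * f (T \<omega> x))"
      using assms(5) finite_cube by (subst integral_measure_pmf_real[of "cube n"]) (auto simp: mult.commute)
    also have "\<dots> = (\<Sum>i=1..N. pmf p (s i) * f (T \<omega> (s i)))"
      by (rule sum.reindex_bij_betw[OF assms(3), symmetric])
    also have "\<dots> \<le> (\<Sum>i=1..M - 1. pmf p (s i) * f (s i))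
        + (1 - (\<Sum>i=1..M - 1. pmf p (s i))) * f (s M)"
      \<comment> \<open>\<open>f (T \<omega> x) \<le> f x\<close> holds because each
        \<open>x\<close> lies in its own neighborhood.\<close>
      using M_pos assms(14) sum_p T_le[OF that(1) s_in] nbh(1)[OF that(1) s_in] cap s_in
      by (intro sum_capped_values_le) auto
    finally show ?thesis .
  qed
  have cap_le: "(\<Sum>i=1..M - 1. pmf p (s i) * f (s i)) + (1 - (\<Sum>i=1..M - 1. pmf p (s i))) * f (s M)
      \<le> f (s M)"
    using assms(4,14) by (intro capped_mean_le) auto
  have nbh_sets: "{\<omega> \<in> space P. Q (Nb \<omega> x)} \<in> sets P" if "x \<in> cube n" for x Q
  proof -
    have "(\<lambda>\<omega>. Nb \<omega> x) \<in> measurable P (count_space UNIV)"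
      using assms(9) that by (auto simp: uniform_random_neighborhoods_def)
    then have "(\<lambda>\<omega>. Nb \<omega> x) -` {A. Q A} \<inter> space P \<in> sets P"
      by (rule measurable_sets) simp
    then show ?thesis
      by (simp add: vimage_def Int_def conj_commute)
  qed
  have bad_sets: "?bad x \<in> sets P" if "x \<in> cube n" for x
    by (rule nbh_sets[OF that])
  have bad_le: "prob (?bad x) \<le> \<delta> / real N" if x: "x \<in> cube n" for x
  \<comment> \<open>A point of \<open>?S\<close> is its own witness, so it is never bad. Otherwise
    \<open>?S\<close> lies in \<open>cube n - {x}\<close> and all \<open>M\<close> of its points can
    be hit by the random part.\<close>
  proof (cases "x \<in> ?S")
    case True
    then have "?bad x = {}"
      using nbh(1) x f_S by blast
    then have "prob (?bad x) = 0"
      by (simp only: measure_empty)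
    then show ?thesis
      using assms(11) by simp
  next
    case False
    have N1: "real (2 ^ n - 1) > 0" "real (2 ^ n - 1) \<le> real N"
      using assms(1) by (auto simp: less_diff_conv intro: one_less_power)
    \<comment> \<open>Only an inclusion: a neighborhood missing \<open>?S\<close> may still contain
      a point whose value ties with \<open>f (s M)\<close>.\<close>
    have "?bad x \<subseteq> {\<omega> \<in> space P. (Nb \<omega> x - {x}) \<inter> ?S = {}}"
      using f_S by blast
    moreover have "{\<omega> \<in> space P. (Nb \<omega> x - {x}) \<inter> ?S = {}} \<in> sets P"
      by (rule nbh_sets[OF x])
    ultimately have "prob (?bad x) \<le> prob {\<omega> \<in> space P. (Nb \<omega> x - {x}) \<inter> ?S = {}}"
      by (rule finite_measure_mono)
    also have "\<dots> \<le> exp (- (real (k x - 1) * real M / real (2 ^ n - 1)))"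
      using prob_neighborhood_misses_le[OF assms(6,9,1) x, of ?S] S_sub False card_S by auto
    also have "\<dots> \<le> exp (- ln (real N / \<delta>))"
    proof -
      \<comment> \<open>The choice of \<open>M\<close> gives the first inequality. Passing from
        \<open>M - 1\<close> to \<open>M\<close>, from \<open>X\<close> to \<open>k x\<close> and
        from the denominator \<open>N\<close> to \<open>N - 1\<close> only helps.\<close>
      have "ln (real N / \<delta>) * real N \<le> (real M - 1) * (real X - 1)"
        using M_ge X_gt by (simp add: field_simps)
      also have "\<dots> \<le> real M * real (k x - 1)"
        using assms(7) assms(8)[OF x] M_pos by (intro mult_mono) auto
      finally have "ln (real N / \<delta>) \<le> real M * real (k x - 1) / real N"
        using N_pos by (simp add: pos_le_divide_eq)
      also have "\<dots> \<le> real M * real (k x - 1) / real (2 ^ n - 1)"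
        using N1 by (intro divide_left_mono) auto
      finally show ?thesis
        by (simp add: mult.commute)
    qed
    also have "\<dots> = \<delta> / real N"
      using N_pos assms(11) by (simp add: exp_minus)
    finally show ?thesis .
  qed
  have Un_sets: "(\<Union>x\<in>cube n. ?bad x) \<in> sets P"
    using bad_sets finite_cube by blast
  have "prob (\<Union>x\<in>cube n. ?bad x) \<le> (\<Sum>x\<in>cube n. prob (?bad x))"
    using bad_sets finite_cube by (intro finite_measure_subadditive_finite) auto
  also have "\<dots> \<le> (\<Sum>x\<in>cube n. \<delta> / real N)"
    by (intro sum_mono bad_le)
  also have "\<dots> = \<delta>"
    by (simp add: card_cube)
  finally have "1 - \<delta> \<le> 1 - prob (\<Union>x\<in>cube n. ?bad x)"
    by simp
  also have "\<dots> = prob (space P - (\<Union>x\<in>cube n. ?bad x))"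
    by (rule prob_compl[OF Un_sets, symmetric])
  also have "space P - (\<Union>x\<in>cube n. ?bad x) = ?G"
    by blast
  \<comment> \<open>The bound on the expectation follows from the first conjunct and the last
    inequality always holds, so the two events coincide. This also makes the event of the theorem
    measurable.\<close>
  also have "?G = {\<omega> \<in> space P.
      (\<forall>x\<in>cube n. f (T \<omega> x) \<in> {f (s 1)..f (s M)}) \<and>
      measure_pmf.expectation p (\<lambda>x. f (T \<omega> x))
        \<le> (\<Sum>i=1..M - 1. pmf p (s i) * f (s i)) + (1 - (\<Sum>i=1..M - 1. pmf p (s i))) * f (s M) \<and>
      (\<Sum>i=1..M - 1. pmf p (s i) * f (s i)) + (1 - (\<Sum>i=1..M - 1. pmf p (s i))) * f (s M)
        \<le> f (s M)}"
    using event mean cap_le by blast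
  finally show ?thesis .
qed

end
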